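(* Let $G$ be a locally compact group acting on a compact space $E$ (so that $E$ is a $G$-space) and let $\mu$ be a probability measure on $G$. (1) If the action of $S_\mu$ on $E$ is orbitwise proximal, that is, the action of $S_\mu$ on the closure $\overline{S_\mu x}$ of every orbit ($x\in E$) is proximal, then $\mu$ has Liouville property on $E$. (2) If the orbit closures $\overline{S_\mu x}$, $x\in E$, are minimal, then $\mu$ has Liouville property on $E$. (3) If the action of $S_\mu$ on $E$ is distal, then $\mu$ has Liouville property on $E$.
   Context: Probability measures on a locally compact group are regular Borel probability measures. $G_\mu$ (resp. $S_\mu$) denotes the closed subgroup (resp. closed subsemigroup) of $G$ generated by the support of $\mu$. A $G$-space $E$ is a locally compact space with a continuous $G$-action. A bounded measurable function $f$ on $E$ is called $\mu$-harmonic if $\int f(gx)\,d\mu(g) = f(x)$ for all $x\in E$. The measure $\mu$ has Liouville property on $E$ if every continuous bounded $\mu$-harmonic function on $E$ is $G_\mu$-invariant. A semigroup $S$ acting on a compact space $E$ is called proximal (resp. distal) if for any two distinct points $x,y\in E$, the closure of $\{(gx,gy)\mid g\in S\}$ meets (resp. does not meet) the diagonal in $E\times E$. A nonempty closed $S_\mu$-invariant set is minimal if it contains no proper nonempty closed $S_\mu$-invariant subset, where a set $A$ is $S_\mu$-invariant if $gA\subset A$ for all $g\in S_\mu$. *)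

theory Defs
  imports "HOL-Probability.Probability"
begin

text \<open>
  A topological group is a type of class \<open>topological_group_add\<close>; this class is not
  commutative, so \<open>g + h\<close>, \<open>- g\<close>, \<open>0\<close> stand for the product, the inverse and the identity of
  an arbitrary topological group. Locally compact groups and compact spaces are Hausdorff
  (class \<open>t2_space\<close>).
\<close>

definition continuous_group_action ::
    "('g::topological_group_add \<Rightarrow> 'e::topological_space \<Rightarrow> 'e) \<Rightarrow> bool" where
  "continuous_group_action act \<longleftrightarrow>
     (\<forall>x. act 0 x = x) \<and>
     (\<forall>g h x. act (g + h) x = act g (act h x)) \<and>
     continuous_on UNIV (\<lambda>(g, x). act g x)"

definition regular_borel_prob :: "'g::t2_space measure \<Rightarrow> bool" where
  "regular_borel_prob \<mu> \<longleftrightarrow>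
     sets \<mu> = sets borel \<and> prob_space \<mu> \<and>
     (\<forall>B\<in>sets borel. emeasure \<mu> B = (SUP K\<in>{K. compact K \<and> K \<subseteq> B}. emeasure \<mu> K)) \<and>
     (\<forall>B\<in>sets borel. emeasure \<mu> B = (INF U\<in>{U. open U \<and> B \<subseteq> U}. emeasure \<mu> U))"

definition measure_support :: "'g::topological_space measure \<Rightarrow> 'g set" where
  "measure_support \<mu> = {g. \<forall>U. open U \<and> g \<in> U \<longrightarrow> emeasure \<mu> U > 0}"

definition closed_subsemigroup :: "'g::topological_group_add set \<Rightarrow> bool" where
  "closed_subsemigroup S \<longleftrightarrow> closed S \<and> (\<forall>g\<in>S. \<forall>h\<in>S. g + h \<in> S)"

definition closed_subgroup :: "'g::topological_group_add set \<Rightarrow> bool" where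
  "closed_subgroup H \<longleftrightarrow>
     closed H \<and> 0 \<in> H \<and> (\<forall>g\<in>H. \<forall>h\<in>H. g + h \<in> H) \<and> (\<forall>g\<in>H. - g \<in> H)"

definition semigroup_of :: "'g::topological_group_add measure \<Rightarrow> 'g set" where
  "semigroup_of \<mu> = closed_subsemigroup hull (measure_support \<mu>)"

definition group_of :: "'g::topological_group_add measure \<Rightarrow> 'g set" where
  "group_of \<mu> = closed_subgroup hull (measure_support \<mu>)"

text \<open>
  Functions are complex valued; real valued ones are included through \<open>of_real\<close>.
\<close>

definition harmonic ::
    "'g measure \<Rightarrow> ('g \<Rightarrow> 'e \<Rightarrow> 'e) \<Rightarrow> ('e::topological_space \<Rightarrow> complex) \<Rightarrow> bool" where
  "harmonic \<mu> act f \<longleftrightarrow>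
     bounded (range f) \<and> f \<in> borel_measurable borel \<and>
     (\<forall>x. (\<integral>g. f (act g x) \<partial>\<mu>) = f x)"

definition liouville ::
    "'g::topological_group_add measure \<Rightarrow> ('g \<Rightarrow> 'e::topological_space \<Rightarrow> 'e) \<Rightarrow> bool" where
  "liouville \<mu> act \<longleftrightarrow>
     (\<forall>f. continuous_on UNIV f \<and> harmonic \<mu> act f \<longrightarrow>
        (\<forall>g\<in>group_of \<mu>. \<forall>x. f (act g x) = f x))"

definition pair_orbit_closure ::
    "'g set \<Rightarrow> ('g \<Rightarrow> 'e \<Rightarrow> 'e) \<Rightarrow> 'e \<Rightarrow> 'e \<Rightarrow> ('e::topological_space \<times> 'e) set" where
  "pair_orbit_closure S act x y = closure ((\<lambda>g. (act g x, act g y)) ` S)"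

text \<open>
  The set \<open>Y\<close> is the space acted upon; it is meant to be a closed \<open>S\<close>-invariant subset of the
  ambient space, so that closures in \<open>Y \<times> Y\<close> and in the ambient product agree.
\<close>

definition proximal_on ::
    "'g set \<Rightarrow> ('g \<Rightarrow> 'e \<Rightarrow> 'e) \<Rightarrow> 'e::topological_space set \<Rightarrow> bool" where
  "proximal_on S act Y \<longleftrightarrow>
     (\<forall>x\<in>Y. \<forall>y\<in>Y. x \<noteq> y \<longrightarrow> pair_orbit_closure S act x y \<inter> range (\<lambda>z. (z, z)) \<noteq> {})"

definition distal_on ::
    "'g set \<Rightarrow> ('g \<Rightarrow> 'e \<Rightarrow> 'e) \<Rightarrow> 'e::topological_space set \<Rightarrow> bool" where
  "distal_on S act Y \<longleftrightarrow>
     (\<forall>x\<in>Y. \<forall>y\<in>Y. x \<noteq> y \<longrightarrow> pair_orbit_closure S act x y \<inter> range (\<lambda>z. (z, z)) = {})"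

definition orbit_closure ::
    "'g set \<Rightarrow> ('g \<Rightarrow> 'e \<Rightarrow> 'e) \<Rightarrow> 'e \<Rightarrow> 'e::topological_space set" where
  "orbit_closure S act x = closure ((\<lambda>g. act g x) ` S)"

definition invariant_set :: "'g set \<Rightarrow> ('g \<Rightarrow> 'e \<Rightarrow> 'e) \<Rightarrow> 'e set \<Rightarrow> bool" where
  "invariant_set S act A \<longleftrightarrow> (\<forall>g\<in>S. act g ` A \<subseteq> A)"

definition minimal_set ::
    "'g set \<Rightarrow> ('g \<Rightarrow> 'e \<Rightarrow> 'e) \<Rightarrow> 'e::topological_space set \<Rightarrow> bool" where
  "minimal_set S act A \<longleftrightarrow>
     A \<noteq> {} \<and> closed A \<and> invariant_set S act A \<and>
     \<not> (\<exists>B. B \<noteq> {} \<and> B \<subset> A \<and> closed B \<and> invariant_set S act B)"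

end

theory Submission
  imports Defs
begin

text \<open>
  All three statements rest on one criterion: if any two nonempty closed \<open>S\<^sub>\<mu>\<close>-invariant
  subsets of each orbit closure meet, then \<open>\<mu>\<close> has the Liouville property
  (\<open>liouville_if_closed_invariant_sets_meet\<close>). Indeed, let \<open>h\<close> be the real or imaginary part of
  a continuous harmonic function. By the maximum principle the set where \<open>h\<close> attains its
  maximum on the closure of \<open>S\<^sub>\<mu> x\<close> is closed and invariant
  (\<open>maximum_set_closed_invariant\<close>), and so is the set where it attains its minimum. If they
  meet, \<open>h\<close> is constant on the orbit closure; averaging over \<open>\<mu>\<close> shows that \<open>h x\<close> is that
  constant. Hence \<open>h (g x) = h x\<close> for \<open>g\<close> in the support of \<open>\<mu>\<close>, and then for \<open>g\<close> in the
  closed group generated by it.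

  Under proximality two such sets meet because the orbit of a pair in their product
  accumulates on the diagonal; if the orbit closure is minimal, both sets equal it. In the
  distal case every nonempty closed invariant subset of the closure of \<open>S\<^sub>\<mu> x\<close> contains \<open>x\<close>
  (\<open>distal_point_in_closed_invariant_subset\<close>): the limits of the maps \<open>act g\<close> that send \<open>x\<close> into
  the subset form a compact semigroup, which has an idempotent \<open>u\<close> by the Ellis--Numakura
  theorem (\<open>compact_map_semigroup_has_idempotent\<close>), and \<open>x\<close>, \<open>u x\<close> have the same image
  under \<open>u\<close>, so they coincide.
\<close>

section \<open>Topological semigroups of self-maps\<close>

lemma compact_UNIV_fun:
  assumes "compact (UNIV :: 'e::topological_space set)"
  shows "compact (UNIV :: ('a \<Rightarrow> 'e) set)"
proof -
  have "compact_space (euclidean :: 'e topology)"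
    using assms by (simp add: compact_space_def compactin_euclidean_iff)
  hence "compact_space (product_topology (\<lambda>_. euclidean) UNIV :: ('a \<Rightarrow> 'e) topology)"
    by (simp add: compact_space_product_topology)
  thus ?thesis
    by (simp add: euclidean_product_topology compact_space_def compactin_euclidean_iff)
qed

lemma compact_imp_closed_fun:
  fixes A :: "('a \<Rightarrow> 'e::t2_space) set"
  assumes "compact A"
  shows "closed A"
proof -
  have "Hausdorff_space (euclidean :: 'e topology)"
    unfolding Hausdorff_space_def disjnt_def by simp (metis hausdorff)
  hence "Hausdorff_space (product_topology (\<lambda>_. euclidean) UNIV :: ('a \<Rightarrow> 'e) topology)"
    by (intro Hausdorff_space_product_topology[THEN iffD2] disjI2 ballI)
  hence "Hausdorff_space (euclidean :: ('a \<Rightarrow> 'e) topology)"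
    by (simp add: euclidean_product_topology)
  thus ?thesis
    using assms compactin_imp_closedin[of euclidean A]
    by (simp add: compactin_euclidean_iff)
qed

lemma continuous_on_eval: "continuous_on A (\<lambda>p. p x)"
  by (rule continuous_on_product_then_coordinatewise) (rule continuous_on_id)

lemma continuous_on_precompose: "continuous_on A (\<lambda>p. p \<circ> q)"
  by (intro continuous_on_coordinatewise_then_product) (simp add: continuous_on_eval)

text \<open>
  Ellis--Numakura. A minimal nonempty closed subsemigroup \<open>K\<close> exists by compactness. For
  \<open>u \<in> K\<close> the set \<open>K \<circ> u\<close> is again a closed subsemigroup, hence all of \<open>K\<close>; so the closed
  subsemigroup of those \<open>k \<in> K\<close> with \<open>k \<circ> u = u\<close> is nonempty, hence also all of \<open>K\<close>, and in
  particular contains \<open>u\<close>. Precomposition with any map is continuous for pointwise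
  convergence, so the argument covers semigroups of discontinuous maps, as they arise as
  limits of continuous ones.
\<close>

lemma compact_map_semigroup_has_idempotent:
  fixes A :: "('e::t2_space \<Rightarrow> 'e) set"
  assumes E: "compact (UNIV :: 'e set)"
    and A: "closed A" "A \<noteq> {}" and comp: "\<And>p q. p \<in> A \<Longrightarrow> q \<in> A \<Longrightarrow> p \<circ> q \<in> A"
  obtains u where "u \<in> A" "u \<circ> u = u"
proof -
  have cU: "compact (UNIV :: ('e \<Rightarrow> 'e) set)" using E by (rule compact_UNIV_fun)
  define F where "F = {K. K \<subseteq> A \<and> closed K \<and> K \<noteq> {} \<and> (\<forall>p\<in>K. \<forall>q\<in>K. p \<circ> q \<in> K)}"
  \<comment> \<open>Zorn's lemma is applied to complements, which turns a minimal set into a maximal one.\<close>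
  have "\<exists>M\<in>{U. -U \<in> F}. \<forall>X\<in>{U. -U \<in> F}. M \<subseteq> X \<longrightarrow> X = M"
  proof (rule subset_Zorn_nonempty)
    have "- A \<in> {U. - U \<in> F}" using A comp by (auto simp: F_def)
    thus "{U. - U \<in> F} \<noteq> {}" by blast
  next
    fix \<C> assume ne: "\<C> \<noteq> {}" and ch: "subset.chain {U. - U \<in> F} \<C>"
    have CF: "- X \<in> F" if "X \<in> \<C>" for X using ch that by (auto simp: subset_chain_def)
    have tot: "X \<subseteq> Y \<or> Y \<subseteq> X" if "X \<in> \<C>" "Y \<in> \<C>" for X Y
      using ch that by (auto simp: subset_chain_def)
    have "UNIV \<inter> (\<Inter>X\<in>\<C>. - X) \<noteq> {}"
    proof (rule compact_imp_fip_image[OF cU])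
      show "closed (- X)" if "X \<in> \<C>" for X using CF[OF that] by (simp add: F_def)
      show "UNIV \<inter> (\<Inter>X\<in>I. - X) \<noteq> {}" if I: "finite I" "I \<subseteq> \<C>" for I
      proof (cases "I = {}")
        case False
        have "subset.chain \<C> I" using I tot by (auto simp: subset_chain_def)
        hence "\<Union>I \<in> I" using False I(1) by (intro Union_in_chain)
        hence "- \<Union>I \<in> F" using I CF by blast
        thus ?thesis by (auto simp: F_def)
      qed simp
    qed
    moreover have "p \<circ> q \<in> (\<Inter>X\<in>\<C>. - X)" if "p \<in> (\<Inter>X\<in>\<C>. - X)" "q \<in> (\<Inter>X\<in>\<C>. - X)" for p q
    proof (rule INT_I)
      fix X assume X: "X \<in> \<C>"
      hence "p \<in> - X" "q \<in> - X" using that by simp_all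
      thus "p \<circ> q \<in> - X" using CF[OF X] by (simp add: F_def)
    qed
    moreover have "(\<Inter>X\<in>\<C>. - X) \<subseteq> A"
    proof -
      obtain X where "X \<in> \<C>" using ne by blast
      thus ?thesis using CF[of X] by (auto simp: F_def)
    qed
    moreover have "closed (\<Inter>X\<in>\<C>. - X)"
      using CF by (intro closed_INT ballI) (simp add: F_def)
    moreover have "- \<Union>\<C> = (\<Inter>X\<in>\<C>. - X)" by blast
    ultimately show "\<Union>\<C> \<in> {U. - U \<in> F}" by (simp add: F_def)
  qed
  then obtain M where M: "- M \<in> F" and Mmax: "\<And>X. - X \<in> F \<Longrightarrow> M \<subseteq> X \<Longrightarrow> X = M" by blast
  define K where "K = - M"
  have K: "K \<subseteq> A" "closed K" "K \<noteq> {}" and Kcomp: "\<And>p q. p \<in> K \<Longrightarrow> q \<in> K \<Longrightarrow> p \<circ> q \<in> K"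
    using M by (auto simp: F_def K_def)
  have minimal: "L = K"
    if "L \<subseteq> K" "closed L" "L \<noteq> {}" "\<And>p q. p \<in> L \<Longrightarrow> q \<in> L \<Longrightarrow> p \<circ> q \<in> L" for L
  proof -
    have "- (- L) \<in> F" using that K by (auto simp: F_def)
    moreover have "M \<subseteq> - L" using that(1) by (auto simp: K_def)
    ultimately have "- L = M" by (rule Mmax)
    thus ?thesis by (auto simp: K_def)
  qed
  obtain u where u: "u \<in> K" using K by blast
  have "(\<lambda>p. p \<circ> u) ` K = K"
  proof (rule minimal)
    have "compact K" using compact_Int_closed[OF cU K(2)] by simp
    thus "closed ((\<lambda>p. p \<circ> u) ` K)"
      by (intro compact_imp_closed_fun compact_continuous_image continuous_on_precompose)
    fix p q assume "p \<in> (\<lambda>p. p \<circ> u) ` K" "q \<in> (\<lambda>p. p \<circ> u) ` K"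
    then obtain p' q' where p': "p = p' \<circ> u" "p' \<in> K" and q': "q = q' \<circ> u" "q' \<in> K" by blast
    have "p \<circ> q = (p' \<circ> (u \<circ> q')) \<circ> u" using p' q' by (simp add: comp_assoc)
    moreover have "p' \<circ> (u \<circ> q') \<in> K" using p' q' u Kcomp by blast
    ultimately show "p \<circ> q \<in> (\<lambda>p. p \<circ> u) ` K" by blast
  qed (use Kcomp u K in auto)
  with u have "u \<in> (\<lambda>p. p \<circ> u) ` K" by simp
  then obtain k where k: "k \<in> K" "k \<circ> u = u" by (metis imageE)
  have "{k \<in> K. k \<circ> u = u} = K"
  proof (rule minimal)
    have "closed {k. k (u x) = u x}" for x
      using continuous_on_eval continuous_on_const by (rule closed_Collect_eq)
    hence "closed (K \<inter> (\<Inter>x. {k. k (u x) = u x}))"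
      using K(2) by (intro closed_Int closed_INT) auto
    moreover have "{k \<in> K. k \<circ> u = u} = K \<inter> (\<Inter>x. {k. k (u x) = u x})"
      by (auto simp: fun_eq_iff)
    ultimately show "closed {k \<in> K. k \<circ> u = u}" by simp
    show "{k \<in> K. k \<circ> u = u} \<noteq> {}" using k by blast
    fix p q assume "p \<in> {k \<in> K. k \<circ> u = u}" "q \<in> {k \<in> K. k \<circ> u = u}"
    thus "p \<circ> q \<in> {k \<in> K. k \<circ> u = u}" using Kcomp by (simp add: comp_assoc)
  qed blast
  with u have "u \<in> {k \<in> K. k \<circ> u = u}" by simp
  hence "u \<circ> u = u" by simp
  moreover have "u \<in> A" using u K(1) by (rule rev_subsetD)
  ultimately show thesis by (intro that)
qed

section \<open>Semigroup actions on compact spaces\<close>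

locale compact_semigroup_action =
  fixes S :: "'g::topological_group_add set" and act :: "'g \<Rightarrow> 'e::t2_space \<Rightarrow> 'e"
  assumes compact_phase_space: "compact (UNIV :: 'e set)"
    and action: "continuous_group_action act"
    and semigroup: "closed_subsemigroup S"
    and nonempty: "S \<noteq> {}"
begin

lemma act_add: "act (g + h) x = act g (act h x)"
  using action by (simp add: continuous_group_action_def)

lemma continuous_on_act: "continuous_on A (act g)"
proof -
  have "continuous_on UNIV (\<lambda>(g, x). act g x)"
    using action by (simp add: continuous_group_action_def)
  moreover have "continuous_on A (\<lambda>x. (g, x))"
    by (intro continuous_on_Pair continuous_on_const continuous_on_id)
  ultimately have "continuous_on A (\<lambda>x. case (g, x) of (g, x) \<Rightarrow> act g x)"
    by (rule continuous_on_compose2) simp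
  thus ?thesis by simp
qed

lemma orbit_closure_invariant: "invariant_set S act (orbit_closure S act x)"
  unfolding invariant_set_def
proof
  fix g assume g: "g \<in> S"
  have "act g ` closure ((\<lambda>g. act g x) ` S) \<subseteq> closure ((\<lambda>g. act g x) ` S)"
  proof (rule image_closure_subset[OF continuous_on_act])
    have "act g (act h x) \<in> (\<lambda>g. act g x) ` S" if "h \<in> S" for h
      using g that semigroup by (auto simp: closed_subsemigroup_def simp flip: act_add)
    thus "act g ` (\<lambda>g. act g x) ` S \<subseteq> closure ((\<lambda>g. act g x) ` S)"
      using closure_subset by blast
  qed simp
  thus "act g ` orbit_closure S act x \<subseteq> orbit_closure S act x"
    by (simp add: orbit_closure_def)
qed

lemma orbit_closure_nonempty: "orbit_closure S act x \<noteq> {}"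
  using nonempty by (simp add: orbit_closure_def)

text \<open>
  If \<open>y \<in> M\<close> and \<open>z \<in> N\<close>, the orbit of \<open>(y, z)\<close> stays in the closed set \<open>M \<times> N\<close>, so any
  diagonal point in its closure is a common point of \<open>M\<close> and \<open>N\<close>.
\<close>

lemma proximal_closed_invariant_sets_meet:
  assumes prox: "proximal_on S act Y"
    and M: "M \<subseteq> Y" "M \<noteq> {}" "closed M" "invariant_set S act M"
    and N: "N \<subseteq> Y" "N \<noteq> {}" "closed N" "invariant_set S act N"
  shows "M \<inter> N \<noteq> {}"
proof -
  obtain y z where yz: "y \<in> M" "z \<in> N" using M N by blast
  show ?thesis
  proof (cases "y = z")
    case False
    then obtain w where w: "(w, w) \<in> pair_orbit_closure S act y z"
      using prox yz M N unfolding proximal_on_def by blast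
    have "act g y \<in> M" "act g z \<in> N" if "g \<in> S" for g
      using that yz M(4) N(4) unfolding invariant_set_def by blast+
    hence "pair_orbit_closure S act y z \<subseteq> M \<times> N"
      unfolding pair_orbit_closure_def using M(3) N(3)
      by (intro closure_minimal closed_Times) auto
    with w show ?thesis by blast
  qed (use yz in blast)
qed

lemma minimal_set_eqI:
  assumes "minimal_set S act Y"
    and "M \<subseteq> Y" "M \<noteq> {}" "closed M" "invariant_set S act M"
  shows "M = Y"
  using assms unfolding minimal_set_def by blast

text \<open>The Ellis enveloping semigroup, with the topology of pointwise convergence.\<close>

definition enveloping_semigroup :: "('e \<Rightarrow> 'e) set" where
  "enveloping_semigroup = closure (act ` S)"

lemma act_in_enveloping_semigroup: "g \<in> S \<Longrightarrow> act g \<in> enveloping_semigroup"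
  unfolding enveloping_semigroup_def by (rule subsetD[OF closure_subset imageI])

text \<open>
  Left multiplication by \<open>act g\<close> is continuous because \<open>act g\<close> is, and right multiplication by
  any map is continuous; extending to the closure one factor at a time, in this order, never
  uses left multiplication by a discontinuous map.
\<close>

lemma enveloping_semigroup_comp:
  assumes p: "p \<in> enveloping_semigroup" and q: "q \<in> enveloping_semigroup"
  shows "p \<circ> q \<in> enveloping_semigroup"
proof -
  have left: "act g \<circ> r \<in> enveloping_semigroup" if g: "g \<in> S" and r: "r \<in> enveloping_semigroup" for g r
  proof -
    have "(\<lambda>r. act g \<circ> r) ` closure (act ` S) \<subseteq> closure (act ` S)"
    proof (rule image_closure_subset)
      show "continuous_on (closure (act ` S)) ((\<circ>) (act g))"
        by (intro continuous_on_coordinatewise_then_product)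
          (simp add: continuous_on_compose2[OF continuous_on_act[of UNIV g] continuous_on_eval])
      have "act g \<circ> act h \<in> act ` S" if "h \<in> S" for h
      proof -
        have "act g \<circ> act h = act (g + h)" by (auto simp: act_add)
        thus ?thesis using g that semigroup by (auto simp: closed_subsemigroup_def)
      qed
      thus "(\<circ>) (act g) ` act ` S \<subseteq> closure (act ` S)" using closure_subset by blast
    qed simp
    thus ?thesis using r by (auto simp: enveloping_semigroup_def)
  qed
  have "(\<lambda>p. p \<circ> q) ` closure (act ` S) \<subseteq> enveloping_semigroup"
    by (rule image_closure_subset[OF continuous_on_precompose])
      (use left q in \<open>auto simp: enveloping_semigroup_def\<close>)
  thus ?thesis using p by (auto simp: enveloping_semigroup_def)
qed

lemma enveloping_semigroup_invariant:
  assumes "closed M" "invariant_set S act M" "p \<in> enveloping_semigroup" "y \<in> M"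
  shows "p y \<in> M"
proof -
  have "(\<lambda>p. p y) ` closure (act ` S) \<subseteq> M"
    by (rule image_closure_subset[OF continuous_on_eval])
      (use assms in \<open>auto simp: invariant_set_def\<close>)
  thus ?thesis using assms(3) by (auto simp: enveloping_semigroup_def)
qed

lemma orbit_closure_subset_enveloping_image:
  "orbit_closure S act x \<subseteq> (\<lambda>p. p x) ` enveloping_semigroup"
  unfolding orbit_closure_def
proof (rule closure_minimal)
  have "compact enveloping_semigroup"
    using compact_Int_closed[OF compact_UNIV_fun[OF compact_phase_space], of enveloping_semigroup]
    by (simp add: enveloping_semigroup_def)
  thus "closed ((\<lambda>p. p x) ` enveloping_semigroup)"
    by (intro compact_imp_closed compact_continuous_image continuous_on_eval)
  show "(\<lambda>g. act g x) ` S \<subseteq> (\<lambda>p. p x) ` enveloping_semigroup"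
  proof (rule image_subsetI)
    fix g assume "g \<in> S"
    thus "act g x \<in> (\<lambda>p. p x) ` enveloping_semigroup"
      by (intro image_eqI[OF refl] act_in_enveloping_semigroup)
  qed
qed

lemma enveloping_map_in_pair_orbit_closure:
  assumes "p \<in> enveloping_semigroup"
  shows "(p x, p y) \<in> pair_orbit_closure S act x y"
proof -
  have "(\<lambda>p. (p x, p y)) ` closure (act ` S) \<subseteq> pair_orbit_closure S act x y"
  proof (rule image_closure_subset)
    show "continuous_on (closure (act ` S)) (\<lambda>p. (p x, p y))"
      by (rule continuous_on_Pair[OF continuous_on_eval continuous_on_eval])
    show "(\<lambda>p. (p x, p y)) ` act ` S \<subseteq> pair_orbit_closure S act x y"
      unfolding pair_orbit_closure_def image_image by (rule closure_subset)
  qed (simp add: pair_orbit_closure_def)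
  moreover have "(p x, p y) \<in> (\<lambda>p. (p x, p y)) ` closure (act ` S)"
    using assms unfolding enveloping_semigroup_def by (rule imageI)
  ultimately show ?thesis by (rule subsetD)
qed

text \<open>
  The limit maps sending \<open>x\<close> into \<open>M\<close> form a closed left ideal, which contains an idempotent
  \<open>u\<close>. Since \<open>u\<close> maps \<open>x\<close> and \<open>u x\<close> to the same point, distality forces \<open>u x = x\<close>. This is
  the semigroup form of the fact that distal points are almost periodic.
\<close>

lemma distal_point_in_closed_invariant_subset:
  assumes dist: "distal_on S act UNIV"
    and M: "M \<subseteq> orbit_closure S act x" "M \<noteq> {}" "closed M" "invariant_set S act M"
  shows "x \<in> M"
proof -
  define I where "I = {p \<in> enveloping_semigroup. p x \<in> M}"
  have "closed I"
  proof -
    have "closed ((\<lambda>p. p x) -` M)"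
      using M(3) continuous_on_eval[of UNIV x] by (simp add: closed_vimage)
    moreover have "I = enveloping_semigroup \<inter> (\<lambda>p. p x) -` M" by (auto simp: I_def)
    ultimately show ?thesis by (simp add: enveloping_semigroup_def closed_Int)
  qed
  moreover have "I \<noteq> {}"
    using M(1,2) orbit_closure_subset_enveloping_image[of x] by (fastforce simp: I_def)
  moreover have "p \<circ> q \<in> I" if "p \<in> I" "q \<in> I" for p q
    using that M enveloping_semigroup_comp enveloping_semigroup_invariant by (auto simp: I_def)
  ultimately obtain u where u: "u \<in> I" "u \<circ> u = u"
    using compact_map_semigroup_has_idempotent[OF compact_phase_space] by metis
  have "u (u x) = u x" using u(2) by (metis comp_apply)
  moreover have "(u x, u (u x)) \<in> pair_orbit_closure S act x (u x)"
    using u(1) by (intro enveloping_map_in_pair_orbit_closure) (simp add: I_def)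
  ultimately have "pair_orbit_closure S act x (u x) \<inter> range (\<lambda>z. (z, z)) \<noteq> {}" by auto
  hence "x = u x" using dist unfolding distal_on_def by blast
  thus ?thesis using u(1) by (simp add: I_def)
qed

end

section \<open>The support of a regular probability measure\<close>

text \<open>
  The complement of the support is a union of open null sets, possibly uncountable; a compact
  subset is covered by finitely many of them, so inner regularity gives measure zero.
\<close>

lemma AE_in_measure_support:
  fixes \<mu> :: "'g::t2_space measure"
  assumes reg: "regular_borel_prob \<mu>"
  shows "AE g in \<mu>. g \<in> measure_support \<mu>"
proof -
  have sets: "sets \<mu> = sets borel" using reg by (simp add: regular_borel_prob_def)
  define \<N> where "\<N> = {U. open U \<and> emeasure \<mu> U = 0}"
  have compl: "- measure_support \<mu> = \<Union>\<N>"
    by (auto simp: measure_support_def \<N>_def zero_less_iff_neq_zero)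
  hence op: "open (- measure_support \<mu>)" by (auto simp: \<N>_def)
  have null: "emeasure \<mu> K = 0" if K: "compact K" "K \<subseteq> - measure_support \<mu>" for K
  proof -
    have cover: "K \<subseteq> \<Union>\<N>" using K compl by simp
    have "open U" if "U \<in> \<N>" for U using that by (simp add: \<N>_def)
    with compactE[OF K(1) cover] obtain D where D: "D \<subseteq> \<N>" "finite D" "K \<subseteq> \<Union>D" by metis
    have "\<Union>D \<in> null_sets \<mu>"
      using D by (intro null_sets_UN'[of D "\<lambda>X. X" \<mu>, simplified] countable_finite)
        (auto simp: \<N>_def null_sets_def sets)
    thus ?thesis
      using D(3) K(1) emeasure_mono[of K "\<Union>D" \<mu>] by (auto simp: null_sets_def)
  qed
  have "emeasure \<mu> (- measure_support \<mu>)
      = (SUP K\<in>{K. compact K \<and> K \<subseteq> - measure_support \<mu>}. emeasure \<mu> K)"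
    using reg op unfolding regular_borel_prob_def by auto
  also have "\<dots> \<le> 0" by (rule SUP_least) (simp add: null)
  finally have "- measure_support \<mu> \<in> null_sets \<mu>"
    using op by (auto simp: null_sets_def sets)
  thus ?thesis by (rule AE_I') auto
qed

lemma measure_support_nonempty:
  fixes \<mu> :: "'g::t2_space measure"
  assumes reg: "regular_borel_prob \<mu>"
  shows "measure_support \<mu> \<noteq> {}"
proof
  assume "measure_support \<mu> = {}"
  hence "AE g in \<mu>. False" using AE_in_measure_support[OF reg] by simp
  thus False using reg by (simp add: regular_borel_prob_def prob_space.AE_False)
qed

text \<open>A continuous function whose average equals its maximum over the support has no room to
  be smaller anywhere on the support: it would be so on an open set of positive measure.\<close>

lemma integral_eq_upper_bound_imp_eq_on_support:
  fixes \<mu> :: "'g::t2_space measure" and \<phi> :: "'g \<Rightarrow> real"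
  assumes reg: "regular_borel_prob \<mu>"
    and cont: "continuous_on UNIV \<phi>" and bdd: "bounded (range \<phi>)"
    and le: "\<And>g. g \<in> measure_support \<mu> \<Longrightarrow> \<phi> g \<le> c"
    and int: "(\<integral>g. \<phi> g \<partial>\<mu>) = c"
    and g: "g \<in> measure_support \<mu>"
  shows "\<phi> g = c"
proof (rule ccontr)
  assume "\<phi> g \<noteq> c"
  with le[OF g] have lt: "\<phi> g < c" by simp
  have sets: "sets \<mu> = sets borel" and prob: "prob_space \<mu>"
    using reg by (auto simp: regular_borel_prob_def)
  interpret prob_space \<mu> by (rule prob)
  have meas: "\<phi> \<in> borel_measurable \<mu>"
    using borel_measurable_continuous_onI[OF cont] measurable_cong_sets[OF sets] by blast
  obtain B where "\<And>g. norm (\<phi> g) \<le> B" using bdd by (auto simp: bounded_iff)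
  hence intble: "integrable \<mu> \<phi>" using meas by (intro integrable_const_bound) auto
  have "(\<integral>g. c - \<phi> g \<partial>\<mu>) = 0" using intble int by (simp add: prob_space)
  moreover have "AE g in \<mu>. 0 \<le> c - \<phi> g"
    using AE_in_measure_support[OF reg] by eventually_elim (use le in simp)
  ultimately have "AE g in \<mu>. c - \<phi> g = 0"
    using intble by (subst (asm) integral_nonneg_eq_0_iff_AE) auto
  hence ae: "AE g in \<mu>. g \<notin> {g. \<phi> g < c}" by eventually_elim simp
  have op: "open {g. \<phi> g < c}" using cont by (intro open_Collect_less) auto
  hence "emeasure \<mu> {g. \<phi> g < c} = 0"
    using ae by (subst (asm) AE_iff_measurable[of "{g. \<phi> g < c}"])
      (auto simp: sets sets_eq_imp_space_eq[OF sets])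
  moreover have "emeasure \<mu> {g. \<phi> g < c} > 0"
    using g op lt unfolding measure_support_def by blast
  ultimately show False by simp
qed

section \<open>Harmonic functions and extremal sets\<close>

lemma measure_support_subset_semigroup_of: "measure_support \<mu> \<subseteq> semigroup_of \<mu>"
  unfolding semigroup_of_def by (rule hull_subset)

lemma closed_subsemigroup_semigroup_of: "closed_subsemigroup (semigroup_of \<mu>)"
  unfolding semigroup_of_def by (rule hull_in) (auto simp: closed_subsemigroup_def)

locale compact_random_walk =
  fixes \<mu> :: "'g::{topological_group_add, t2_space} measure"
    and act :: "'g \<Rightarrow> 'e::t2_space \<Rightarrow> 'e"
  assumes compact_state_space: "compact (UNIV :: 'e set)"
    and continuous_action: "continuous_group_action act"
    and regular: "regular_borel_prob \<mu>"

sublocale compact_random_walk \<subseteq> compact_semigroup_action "semigroup_of \<mu>" act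
proof
  show "semigroup_of \<mu> \<noteq> {}"
    using measure_support_nonempty[OF regular] measure_support_subset_semigroup_of[of \<mu>] by blast
qed (simp_all add: compact_state_space continuous_action closed_subsemigroup_semigroup_of)

context compact_random_walk
begin

lemma continuous_on_orbit_map: "continuous_on A (\<lambda>g. act g x)"
proof -
  have "continuous_on UNIV (\<lambda>(g, x). act g x)"
    using continuous_action by (simp add: continuous_group_action_def)
  moreover have "continuous_on A (\<lambda>g. (g, x))"
    by (intro continuous_on_Pair continuous_on_const continuous_on_id)
  ultimately have "continuous_on A (\<lambda>g. case (g, x) of (g, x) \<Rightarrow> act g x)"
    by (rule continuous_on_compose2) simp
  thus ?thesis by simp
qed

lemma continuous_on_along_orbit:
  assumes "continuous_on UNIV h"
  shows "continuous_on UNIV (\<lambda>g. h (act g x))"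
  using continuous_on_compose2[OF assms continuous_on_orbit_map] by simp

text \<open>The elements mapping a closed set into itself form a closed semigroup, so it is enough to
  test them on generators.\<close>

lemma invariant_setI_support:
  assumes P: "closed P" and supp: "\<And>g y. g \<in> measure_support \<mu> \<Longrightarrow> y \<in> P \<Longrightarrow> act g y \<in> P"
  shows "invariant_set (semigroup_of \<mu>) act P"
proof -
  have "closed {g. \<forall>y\<in>P. act g y \<in> P}"
  proof -
    have "closed (\<Inter>y\<in>P. (\<lambda>g. act g y) -` P)"
      using P continuous_on_orbit_map by (intro closed_INT ballI closed_vimage) auto
    moreover have "{g. \<forall>y\<in>P. act g y \<in> P} = (\<Inter>y\<in>P. (\<lambda>g. act g y) -` P)" by auto
    ultimately show ?thesis by simp
  qed
  hence "closed_subsemigroup {g. \<forall>y\<in>P. act g y \<in> P}"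
    by (auto simp: closed_subsemigroup_def act_add)
  hence "semigroup_of \<mu> \<subseteq> {g. \<forall>y\<in>P. act g y \<in> P}"
    unfolding semigroup_of_def using supp by (intro hull_minimal) auto
  thus ?thesis by (auto simp: invariant_set_def)
qed

text \<open>The maximum principle: at a maximum point \<open>y\<close> the mean of \<open>h (g y)\<close> is the maximum of
  \<open>h\<close>, so \<open>g y\<close> is again a maximum point for every \<open>g\<close> in the support.\<close>

lemma maximum_set_closed_invariant:
  fixes h :: "'e \<Rightarrow> real"
  assumes cont: "continuous_on UNIV h" and mean: "\<And>x. (\<integral>g. h (act g x) \<partial>\<mu>) = h x"
    and Y: "closed Y" "Y \<noteq> {}" "invariant_set (semigroup_of \<mu>) act Y"
  defines "P \<equiv> {y \<in> Y. \<forall>z\<in>Y. h z \<le> h y}"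
  shows "closed P" "P \<noteq> {}" "invariant_set (semigroup_of \<mu>) act P"
proof -
  have bdd: "bounded (range h)"
    using compact_continuous_image[OF cont compact_state_space] by (rule compact_imp_bounded)
  have "closed {y. h z \<le> h y}" for z
    using cont by (intro closed_Collect_le) auto
  hence "closed (Y \<inter> (\<Inter>z\<in>Y. {y. h z \<le> h y}))" using Y(1) by (intro closed_Int closed_INT) auto
  moreover have "P = Y \<inter> (\<Inter>z\<in>Y. {y. h z \<le> h y})" by (auto simp: P_def)
  ultimately show "closed P" by simp
  have "compact Y" using compact_Int_closed[OF compact_state_space Y(1)] by simp
  thus "P \<noteq> {}"
    using continuous_attains_sup[of Y h] Y(2) continuous_on_subset[OF cont] by (auto simp: P_def)
  show "invariant_set (semigroup_of \<mu>) act P"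
  proof (rule invariant_setI_support[OF \<open>closed P\<close>])
    fix g y assume g: "g \<in> measure_support \<mu>" and y: "y \<in> P"
    have inY: "act g' y \<in> Y" if "g' \<in> measure_support \<mu>" for g'
      using that y Y(3) measure_support_subset_semigroup_of[of \<mu>]
      by (auto simp: invariant_set_def P_def)
    have "h (act g y) = h y"
    proof (rule integral_eq_upper_bound_imp_eq_on_support[OF regular, where \<phi> = "\<lambda>g. h (act g y)"])
      show "bounded (range (\<lambda>g. h (act g y)))" using bdd by (rule bounded_subset) auto
    qed (use inY y mean g cont in \<open>auto simp: P_def intro: continuous_on_along_orbit\<close>)
    thus "act g y \<in> P" using inY[OF g] y by (auto simp: P_def)
  qed
qed

text \<open>The maximum set and the minimum set of \<open>h\<close> on the orbit closure share a point, so \<open>h\<close> is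
  constant there. As the semigroup need not contain the identity, \<open>x\<close> itself may lie outside its
  orbit closure; the value at \<open>x\<close> is recovered from the mean value property.\<close>

lemma mean_value_function_support_invariant:
  fixes h :: "'e \<Rightarrow> real"
  assumes meet: "\<And>M N. \<lbrakk>M \<subseteq> orbit_closure (semigroup_of \<mu>) act x; M \<noteq> {}; closed M;
        invariant_set (semigroup_of \<mu>) act M;
        N \<subseteq> orbit_closure (semigroup_of \<mu>) act x; N \<noteq> {}; closed N;
        invariant_set (semigroup_of \<mu>) act N\<rbrakk> \<Longrightarrow> M \<inter> N \<noteq> {}"
    and cont: "continuous_on UNIV h" and mean: "\<And>x. (\<integral>g. h (act g x) \<partial>\<mu>) = h x"
    and g: "g \<in> measure_support \<mu>"
  shows "h (act g x) = h x"
proof -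
  define Y where "Y = orbit_closure (semigroup_of \<mu>) act x"
  have Y: "closed Y" "Y \<noteq> {}" "invariant_set (semigroup_of \<mu>) act Y"
    using orbit_closure_nonempty orbit_closure_invariant by (simp_all add: Y_def orbit_closure_def)
  let ?M = "{y \<in> Y. \<forall>z\<in>Y. h z \<le> h y}"
  let ?N = "{y \<in> Y. \<forall>z\<in>Y. - h z \<le> - h y}"
  have mean': "(\<integral>g. - h (act g x) \<partial>\<mu>) = - h x" for x using mean by simp
  note M = maximum_set_closed_invariant[OF cont mean Y]
    and N = maximum_set_closed_invariant[OF continuous_on_minus[OF cont] mean' Y]
  have "?M \<inter> ?N \<noteq> {}"
    by (rule meet[folded Y_def, OF _ M(2,1,3) _ N(2,1,3)]) auto
  then obtain w where w: "\<And>y. y \<in> Y \<Longrightarrow> h y = h w" by fastforce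
  have on_supp: "h (act g' x) = h w" if "g' \<in> measure_support \<mu>" for g'
  proof (rule w)
    show "act g' x \<in> Y"
      unfolding Y_def orbit_closure_def
      using subsetD[OF measure_support_subset_semigroup_of that]
      by (rule subsetD[OF closure_subset imageI])
  qed
  interpret prob_space \<mu> using regular by (simp add: regular_borel_prob_def)
  have "sets \<mu> = sets borel" using regular by (simp add: regular_borel_prob_def)
  hence meas: "(\<lambda>g. h (act g x)) \<in> borel_measurable \<mu>"
    using borel_measurable_continuous_onI[OF continuous_on_along_orbit[OF cont]]
      measurable_cong_sets by blast
  have "AE g' in \<mu>. h (act g' x) = h w"
    using AE_in_measure_support[OF regular] by eventually_elim (rule on_supp)
  hence "(\<integral>g'. h (act g' x) \<partial>\<mu>) = (\<integral>g'. h w \<partial>\<mu>)"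
    using meas by (intro integral_cong_AE) auto
  hence "h x = h w" using mean by (simp add: prob_space)
  thus ?thesis using on_supp[OF g] by simp
qed

text \<open>The elements fixing a continuous function form a closed group, so invariance passes from
  the support to the closed group that it generates.\<close>

lemma group_of_invariant:
  fixes f :: "'e \<Rightarrow> complex"
  assumes cont: "continuous_on UNIV f"
    and supp: "\<And>g x. g \<in> measure_support \<mu> \<Longrightarrow> f (act g x) = f x"
    and g: "g \<in> group_of \<mu>"
  shows "f (act g x) = f x"
proof -
  let ?H = "{g. \<forall>x. f (act g x) = f x}"
  have act0: "act 0 x = x" for x using continuous_action by (simp add: continuous_group_action_def)
  have "closed {g. f (act g x) = f x}" for x
    using continuous_on_along_orbit[OF cont] by (intro closed_Collect_eq) auto
  hence "closed ?H" by (rule closed_Collect_all)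
  moreover have "f (act (- g) x) = f x" if "g \<in> ?H" for g x
  proof -
    have "f (act (- g) x) = f (act g (act (- g) x))" using that by simp
    also have "\<dots> = f x" by (simp add: act0 flip: act_add)
    finally show ?thesis .
  qed
  ultimately have "closed_subgroup ?H"
    unfolding closed_subgroup_def by (auto simp: act0 act_add)
  hence "group_of \<mu> \<subseteq> ?H"
    unfolding group_of_def using supp by (intro hull_minimal) auto
  thus ?thesis using g by blast
qed

lemma liouville_if_closed_invariant_sets_meet:
  assumes meet: "\<And>x M N. \<lbrakk>M \<subseteq> orbit_closure (semigroup_of \<mu>) act x; M \<noteq> {}; closed M;
        invariant_set (semigroup_of \<mu>) act M;
        N \<subseteq> orbit_closure (semigroup_of \<mu>) act x; N \<noteq> {}; closed N;
        invariant_set (semigroup_of \<mu>) act N\<rbrakk> \<Longrightarrow> M \<inter> N \<noteq> {}"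
  shows "liouville \<mu> act"
  unfolding liouville_def
proof (intro allI impI ballI)
  fix f :: "'e \<Rightarrow> complex" and g x
  assume f: "continuous_on UNIV f \<and> harmonic \<mu> act f" and g: "g \<in> group_of \<mu>"
  hence cont: "continuous_on UNIV f" and bdd: "bounded (range f)"
    and mean: "\<And>x. (\<integral>g. f (act g x) \<partial>\<mu>) = f x" by (auto simp: harmonic_def)
  interpret prob_space \<mu> using regular by (simp add: regular_borel_prob_def)
  have sets: "sets \<mu> = sets borel" using regular by (simp add: regular_borel_prob_def)
  obtain B where B: "\<And>x. norm (f x) \<le> B" using bdd by (auto simp: bounded_iff)
  have "(\<lambda>g. f (act g x)) \<in> borel_measurable \<mu>" for x
    using borel_measurable_continuous_onI[OF continuous_on_along_orbit[OF cont]]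
      measurable_cong_sets[OF sets] by blast
  hence intble: "integrable \<mu> (\<lambda>g. f (act g x))" for x
    using B by (intro integrable_const_bound) auto
  have means: "(\<integral>g. Re (f (act g x)) \<partial>\<mu>) = Re (f x)" "(\<integral>g. Im (f (act g x)) \<partial>\<mu>) = Im (f x)"
    for x using intble[of x] mean[of x] by simp_all
  have "f (act g x) = f x" if g: "g \<in> measure_support \<mu>" for g x
  proof (rule complex_eqI)
    show "Re (f (act g x)) = Re (f x)"
      by (rule mean_value_function_support_invariant[where h = "\<lambda>x. Re (f x)",
            OF meet continuous_on_Re[OF cont] means(1) g])
    show "Im (f (act g x)) = Im (f x)"
      by (rule mean_value_function_support_invariant[where h = "\<lambda>x. Im (f x)",
            OF meet continuous_on_Im[OF cont] means(2) g])
  qed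
  thus "f (act g x) = f x" using group_of_invariant[OF cont _ g] by blast
qed

end

theorem corollary2p1:
  fixes \<mu> :: "'g::{topological_group_add, t2_space} measure"
    and act :: "'g \<Rightarrow> 'e::t2_space \<Rightarrow> 'e"
  assumes "locally_compact_space (euclidean :: 'g topology)"
    and "compact (UNIV :: 'e set)"
    and "continuous_group_action act"
    and "regular_borel_prob \<mu>"
  shows "((\<forall>x. proximal_on (semigroup_of \<mu>) act (orbit_closure (semigroup_of \<mu>) act x))
            \<longrightarrow> liouville \<mu> act)
       \<and> ((\<forall>x. minimal_set (semigroup_of \<mu>) act (orbit_closure (semigroup_of \<mu>) act x))
            \<longrightarrow> liouville \<mu> act)
       \<and> (distal_on (semigroup_of \<mu>) act UNIV \<longrightarrow> liouville \<mu> act)"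
proof -
  interpret compact_random_walk \<mu> act
    using assms(2-4) by unfold_locales
  show ?thesis
  proof (intro conjI impI)
    assume "\<forall>x. proximal_on (semigroup_of \<mu>) act (orbit_closure (semigroup_of \<mu>) act x)"
    thus "liouville \<mu> act"
      by (intro liouville_if_closed_invariant_sets_meet) (rule proximal_closed_invariant_sets_meet, auto)
  next
    assume "\<forall>x. minimal_set (semigroup_of \<mu>) act (orbit_closure (semigroup_of \<mu>) act x)"
    thus "liouville \<mu> act"
      by (intro liouville_if_closed_invariant_sets_meet) (metis inf.idem minimal_set_eqI)
  next
    assume "distal_on (semigroup_of \<mu>) act UNIV"
    thus "liouville \<mu> act"
      using distal_point_in_closed_invariant_subset
      by (intro liouville_if_closed_invariant_sets_meet) blast
  qed
qed

end
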